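(* For every integer $n\ge3$, $$H_{n-1}^3+H_{n-2}^2H_{n+1}+H_{n-3}H_n^2-2H_{n-2}H_{n-1}H_n-H_{n-3}H_{n-1}H_{n+1}=41.$$
   Context: The generalized Tribonacci sequence $(H_n)_{n\ge0}$ is defined by $H_0=3$, $H_1=0$, $H_2=2$ and $H_{n+2}=H_{n+1}+H_n+H_{n-1}$ for $n\ge1$. *)

theory Defs
  imports Main
begin

text \<open>Integer-valued, so that the subtractions in statements about the sequence do not truncate.\<close>

fun H :: "nat \<Rightarrow> int" where
  "H 0 = 3"
| "H (Suc 0) = 0"
| "H (Suc (Suc 0)) = 2"
| "H (Suc (Suc (Suc n))) = H (Suc (Suc n)) + H (Suc n) + H n"

end

theory Submission
  imports Defs
begin

text \<open>The left-hand side is minus the Hankel determinant of five consecutive terms. Advancing the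
  index by one multiplies the Hankel matrix by the companion matrix of the recurrence, which has
  determinant 1, so the expression does not depend on the index.\<close>

lemma H_hankel_det:
  "H (k + 2) ^ 3 + H (k + 1) ^ 2 * H (k + 4) + H k * H (k + 3) ^ 2
     - 2 * H (k + 1) * H (k + 2) * H (k + 3) - H k * H (k + 2) * H (k + 4) = 41"
proof (induction k)
  case 0
  \<comment> \<open>The first five terms are 3, 0, 2, 5, 7, and 8 + 75 - 42 = 41.\<close>
  show ?case by (simp add: eval_nat_numeral)
next
  case (Suc k)
  \<comment> \<open>With indices in \<open>Suc\<close> form the recurrence rewrites both the
    hypothesis and the goal as polynomials in \<open>H k\<close>, \<open>H (k + 1)\<close>,
    \<open>H (k + 2)\<close>; these two polynomials coincide.\<close>
  then show ?case
    by (simp add: eval_nat_numeral algebra_simps)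
qed

theorem theorem2p5:
  fixes n :: nat
  assumes "n \<ge> 3"
  shows "H (n - 1) ^ 3 + H (n - 2) ^ 2 * H (n + 1) + H (n - 3) * H n ^ 2
           - 2 * H (n - 2) * H (n - 1) * H n - H (n - 3) * H (n - 1) * H (n + 1) = 41"
proof -
  \<comment> \<open>Writing \<open>n\<close> as \<open>k + 3\<close> removes the truncated
    subtractions: \<open>n - 3\<close> becomes \<open>k\<close>.\<close>
  obtain k where "n = k + 3"
    using assms by (metis add.commute le_Suc_ex)
  then show ?thesis
    using H_hankel_det[of k] by (simp add: add.commute)
qed

end
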